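(* Let $P_1,\dots,P_s\in\mathbb{Z}[T]$ be irreducible polynomials such that the product $P_1\cdots P_s$ has no fixed divisor with respect to $T$. Then for every integer $d\geq 1$ there exist monic polynomials $M(T)\in\mathbb{Z}[T]$ of degree $d$ such that $P_1(M(T)),\dots,P_s(M(T))$ are irreducible in $\mathbb{Z}[T]$ and the product $P_1(M(T))\cdots P_s(M(T))$ has no fixed divisor with respect to $T$.
   Context: For $P\in\mathbb{Z}[T]$, an integer $a\notin\{0,1,-1\}$ is a fixed divisor of $P$ with respect to $T$ if $a$ divides $P(m)$ for every $m\in\mathbb{Z}$. *)

theory Defs
  imports "HOL-Computational_Algebra.Computational_Algebra"
begin

definition fixed_divisor :: "int \<Rightarrow> int poly \<Rightarrow> bool" where
  "fixed_divisor a P \<longleftrightarrow> a \<notin> {0, 1, -1} \<and> (\<forall>m. a dvd poly P m)"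

definition has_fixed_divisor :: "int poly \<Rightarrow> bool" where
  "has_fixed_divisor P \<longleftrightarrow> (\<exists>a. fixed_divisor a P)"

end

theory Submission
  imports Defs "Jordan_Normal_Form.Determinant" "HOL-Number_Theory.Cong"
begin

text \<open>
  It suffices to take \<open>M = T^d + m\<close>. For each \<open>i\<close> choose, by the infinitude of prime divisors of values
  of \<open>P\<^sub>i\<close>, a prime \<open>p\<close> dividing some value of \<open>P\<^sub>i\<close> exactly once; the Chinese remainder theorem then
  gives \<open>m\<close> such that each \<open>P\<^sub>i(m)\<close> is divisible exactly once by a prime, and such that no prime
  \<open>l \<le> d \<Sum> deg P\<^sub>i\<close> divides \<open>\<Prod> P\<^sub>i(M(0))\<close>. A larger prime cannot divide all values of
  \<open>\<Prod> P\<^sub>i(M)\<close>, because this polynomial is primitive and of degree less than the prime.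

  Irreducibility of \<open>P(T^d)\<close>, when \<open>P\<close> is irreducible and \<open>p\<close> divides \<open>P(0)\<close> exactly once, is an
  Eisenstein-type argument with the norm from \<open>\<int>[T]\<close> to its subring \<open>\<int>[T^d]\<close>, over which it is free
  with basis \<open>1, T, \<dots>, T^(d-1)\<close>.
\<close>

section \<open>Polynomials as a free module over the polynomials in \<open>T^d\<close>\<close>

text \<open>This is the coordinate of \<open>f\<close> at \<open>T^j\<close> over the subring of
  polynomials in \<open>T^d\<close>, with \<open>T^d\<close> renamed to the variable. The bound
  \<open>degree f\<close> is only a convenient one: all later terms vanish when
  \<open>d > 0\<close>.\<close>

definition section_poly :: "nat \<Rightarrow> nat \<Rightarrow> 'a::comm_semiring_1 poly \<Rightarrow> 'a poly" where
  "section_poly d j f = (\<Sum>k\<le>degree f. monom (coeff f (k * d + j)) k)"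

lemma coeff_section_poly:
  assumes "d > 0"
  shows "coeff (section_poly d j f) k = coeff f (k * d + j)"
proof -
  have "coeff (section_poly d j f) k = (if k \<le> degree f then coeff f (k * d + j) else 0)"
    by (simp add: section_poly_def coeff_sum)
  moreover have "k \<le> k * d + j"
    using assms by (simp add: trans_le_add1)
  ultimately show ?thesis
    by (auto intro: coeff_eq_0)
qed

lemma section_poly_eqI:
  assumes "d > 0" "\<And>j. j < d \<Longrightarrow> section_poly d j f = section_poly d j g"
  shows "f = g"
proof (rule poly_eqI)
  fix n
  have "coeff f (n div d * d + n mod d) = coeff g (n div d * d + n mod d)"
    using assms by (metis coeff_section_poly mod_less_divisor)
  then show "coeff f n = coeff g n"
    by simp
qed

lemma section_poly_add:
  "d > 0 \<Longrightarrow> section_poly d j (f + g) = section_poly d j f + section_poly d j g"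
  by (simp add: poly_eq_iff coeff_section_poly)

lemma section_poly_0 [simp]: "section_poly d j 0 = 0"
  by (simp add: section_poly_def)

lemma section_poly_sum:
  "d > 0 \<Longrightarrow> section_poly d j (sum f A) = (\<Sum>a\<in>A. section_poly d j (f a))"
  by (induction A rule: infinite_finite_induct) (simp_all add: section_poly_add)

lemma section_poly_smult:
  "d > 0 \<Longrightarrow> section_poly d j (Polynomial.smult c f) = Polynomial.smult c (section_poly d j f)"
  by (simp add: poly_eq_iff coeff_section_poly)

lemma section_poly_monom_mult:
  assumes "d > 0" "j < d"
  shows "section_poly d j (monom 1 d * f) = pCons 0 (section_poly d j f)"
  using assms
  by (auto simp: poly_eq_iff coeff_section_poly coeff_monom_mult coeff_pCons split: nat.split)

text \<open>Linearity of the coordinates over the subring. By induction on \<open>f\<close> it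
  reduces to scalars and to multiplication by \<open>T^d\<close>, which shifts every coordinate by
  one.\<close>

lemma section_poly_pcompose_monom_mult:
  fixes f g :: "'a::comm_ring_1 poly"
  assumes "d > 0" "j < d"
  shows "section_poly d j (pcompose f (monom 1 d) * g) = f * section_poly d j g"
proof (induction f)
  case (pCons a f)
  have "pcompose (pCons a f) (monom 1 d) * g = Polynomial.smult a g + monom 1 d * (pcompose f (monom 1 d) * g)"
    by (simp add: pcompose_pCons algebra_simps)
  then show ?case
    using assms pCons
    by (simp add: section_poly_add section_poly_smult section_poly_monom_mult)
qed simp

lemma section_poly_monom:
  assumes "i < d" "j < d"
  shows "section_poly d j (monom 1 i) = (if i = j then 1 else 0)"
proof (rule poly_eqI)
  fix k
  have "i = k * d + j \<longleftrightarrow> k = 0 \<and> i = j"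
    using assms by (cases k) auto
  then show "coeff (section_poly d j (monom 1 i)) k = coeff (if i = j then 1 else 0) k"
    using assms by (auto simp: coeff_section_poly)
qed

lemma section_poly_decompose:
  fixes f :: "'a::comm_ring_1 poly"
  assumes "d > 0"
  shows "f = (\<Sum>j<d. pcompose (section_poly d j f) (monom 1 d) * monom 1 j)"
proof (rule section_poly_eqI[OF assms])
  fix i assume i: "i < d"
  have "section_poly d i (\<Sum>j<d. pcompose (section_poly d j f) (monom 1 d) * monom 1 j)
      = (\<Sum>j<d. section_poly d i (pcompose (section_poly d j f) (monom 1 d) * monom 1 j))"
    using assms by (rule section_poly_sum)
  also have "\<dots> = (\<Sum>j<d. if j = i then section_poly d j f else 0)"
    using assms i
    by (intro sum.cong) (simp_all add: section_poly_pcompose_monom_mult section_poly_monom)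
  also have "\<dots> = section_poly d i f"
    using i by simp
  finally show "section_poly d i f
      = section_poly d i (\<Sum>j<d. pcompose (section_poly d j f) (monom 1 d) * monom 1 j)" ..
qed

section \<open>Multiplication matrices and the norm\<close>

text \<open>Multiplication by \<open>g\<close> in the basis \<open>1, T, \<dots>, T^(d-1)\<close>; the entries are polynomials in \<open>T^d\<close>,
  written as polynomials in a new variable.\<close>

definition mult_matrix :: "nat \<Rightarrow> 'a::comm_ring_1 poly \<Rightarrow> 'a poly mat" where
  "mult_matrix d g = mat d d (\<lambda>(i, j). section_poly d j (monom 1 i * g))"

lemma mult_matrix_carrier [simp]: "mult_matrix d g \<in> carrier_mat d d"
  by (simp add: mult_matrix_def)

text \<open>Row \<open>i\<close> holds the coordinates of \<open>T^i * g\<close>. Expanding this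
  product in the basis before multiplying by \<open>h\<close> yields the matrix product in the
  stated order.\<close>

lemma mult_matrix_mult:
  assumes "d > 0"
  shows "mult_matrix d (g * h) = mult_matrix d g * mult_matrix d h"
proof (rule eq_matI)
  fix i k assume "i < dim_row (mult_matrix d g * mult_matrix d h)" "k < dim_col (mult_matrix d g * mult_matrix d h)"
  then have ik: "i < d" "k < d"
    by (simp_all add: mult_matrix_def)
  have "monom 1 i * (g * h) = monom 1 i * g * h"
    by (simp add: mult.assoc)
  also have "\<dots> = (\<Sum>j<d. pcompose (section_poly d j (monom 1 i * g)) (monom 1 d) * monom 1 j) * h"
    using section_poly_decompose[OF assms, of "monom 1 i * g"] by simp
  also have "\<dots> = (\<Sum>j<d. pcompose (section_poly d j (monom 1 i * g)) (monom 1 d) * (monom 1 j * h))"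
    by (simp add: sum_distrib_right mult.assoc)
  finally have "section_poly d k (monom 1 i * (g * h))
      = (\<Sum>j<d. section_poly d j (monom 1 i * g) * section_poly d k (monom 1 j * h))"
    using assms ik by (simp add: section_poly_sum section_poly_pcompose_monom_mult)
  then show "mult_matrix d (g * h) $$ (i, k) = (mult_matrix d g * mult_matrix d h) $$ (i, k)"
    using ik by (simp add: mult_matrix_def scalar_prod_def atLeast0LessThan)
qed (simp_all add: mult_matrix_def)

lemma mult_matrix_pcompose:
  assumes "d > 0"
  shows "mult_matrix d (pcompose f (monom 1 d)) = f \<cdot>\<^sub>m 1\<^sub>m d"
proof (rule eq_matI)
  fix i j assume "i < dim_row (f \<cdot>\<^sub>m 1\<^sub>m d)" "j < dim_col (f \<cdot>\<^sub>m 1\<^sub>m d)"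
  then have "i < d" "j < d"
    by simp_all
  then show "mult_matrix d (pcompose f (monom 1 d)) $$ (i, j) = (f \<cdot>\<^sub>m 1\<^sub>m d) $$ (i, j)"
    using assms section_poly_pcompose_monom_mult[of d j f "monom 1 i"]
    by (simp add: mult_matrix_def section_poly_monom mult.commute)
qed (simp_all add: mult_matrix_def)

definition norm_poly :: "nat \<Rightarrow> 'a::comm_ring_1 poly \<Rightarrow> 'a poly" where
  "norm_poly d g = det (mult_matrix d g)"

lemma norm_poly_mult:
  "d > 0 \<Longrightarrow> norm_poly d (g * h) = norm_poly d g * norm_poly d h"
  by (simp add: norm_poly_def mult_matrix_mult det_mult[OF mult_matrix_carrier mult_matrix_carrier])

lemma norm_poly_pcompose:
  "d > 0 \<Longrightarrow> norm_poly d (pcompose f (monom 1 d)) = f ^ d"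
  by (simp add: norm_poly_def mult_matrix_pcompose)

text \<open>Telescoping, one factor at a time; this replaces computing in the quotient ring modulo
  \<open>c\<close>.\<close>

lemma dvd_diff_prod:
  fixes f g :: "'b \<Rightarrow> 'a::comm_ring_1"
  assumes "\<And>x. x \<in> S \<Longrightarrow> c dvd f x - g x"
  shows "c dvd prod f S - prod g S"
  using assms
proof (induction S rule: infinite_finite_induct)
  case (insert x S)
  have "prod f (insert x S) - prod g (insert x S)
      = (f x - g x) * prod f S + g x * (prod f S - prod g S)"
    using insert by (simp add: algebra_simps)
  moreover have "c dvd \<dots>"
    using insert by (intro dvd_add dvd_mult dvd_mult2) auto
  ultimately show ?case
    by simp
qed simp_all

text \<open>By the Leibniz formula, a determinant is a polynomial in the entries and so respects
  congruences.\<close>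

lemma dvd_diff_det:
  fixes A B :: "'a::comm_ring_1 mat"
  assumes A: "A \<in> carrier_mat n n" and B: "B \<in> carrier_mat n n"
    and dvd: "\<And>i j. i < n \<Longrightarrow> j < n \<Longrightarrow> c dvd A $$ (i, j) - B $$ (i, j)"
  shows "c dvd det A - det B"
proof -
  have "c dvd signof p * ((\<Prod>i = 0..<n. A $$ (i, p i)) - (\<Prod>i = 0..<n. B $$ (i, p i)))"
    if "p permutes {0..<n}" for p
    using permutes_in_image[OF that] dvd by (intro dvd_mult dvd_diff_prod) auto
  then show ?thesis
    by (auto simp: det_def'[OF A] det_def'[OF B] sum_subtractf[symmetric] right_diff_distrib[symmetric]
             intro!: dvd_sum)
qed

text \<open>The vector of the powers of \<open>T\<close> below \<open>T^d\<close> is an eigenvector of the multiplication matrix,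
  after substituting \<open>T^d\<close> into its entries, with eigenvalue \<open>g\<close>.\<close>

lemma dvd_norm_poly_pcompose:
  fixes g :: "'a::idom poly"
  assumes "d > 0"
  shows "g dvd pcompose (norm_poly d g) (monom 1 d)"
proof -
  define B where "B = map_mat (\<lambda>a. pcompose a (monom 1 d)) (mult_matrix d g)"
  define v where "v = vec d (\<lambda>j. monom (1::'a) j)"
  \<comment> \<open>Ring homomorphisms commute with determinants, so \<open>det B\<close> is the
    norm of \<open>g\<close> with \<open>T^d\<close> substituted.\<close>
  interpret comm_ring_hom "\<lambda>a::'a poly. pcompose a (monom 1 d)"
    by unfold_locales (simp_all add: pcompose_add pcompose_mult pcompose_1)
  have B: "B \<in> carrier_mat d d"
    by (simp add: B_def mult_matrix_def)
  have C: "B - g \<cdot>\<^sub>m 1\<^sub>m d \<in> carrier_mat d d"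
    using B by auto
  have "(B - g \<cdot>\<^sub>m 1\<^sub>m d) *\<^sub>v v = 0\<^sub>v d"
  proof (rule eq_vecI)
    fix i assume "i < dim_vec (0\<^sub>v d :: 'a poly vec)"
    then have i: "i < d" by simp
    have "(\<Sum>j<d. (B - g \<cdot>\<^sub>m 1\<^sub>m d) $$ (i, j) * v $ j)
        = (\<Sum>j<d. pcompose (section_poly d j (monom 1 i * g)) (monom 1 d) * monom 1 j
          - (if j = i then g * monom 1 j else 0))"
      using i B by (intro sum.cong) (simp_all add: B_def v_def mult_matrix_def left_diff_distrib)
    also have "\<dots> = (\<Sum>j<d. pcompose (section_poly d j (monom 1 i * g)) (monom 1 d) * monom 1 j)
          - (\<Sum>j<d. if j = i then g * monom 1 j else 0)"
      by (rule sum_subtractf)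
    also have "\<dots> = 0"
      using i section_poly_decompose[OF assms, of "monom 1 i * g"] by (simp add: mult.commute)
    finally show "((B - g \<cdot>\<^sub>m 1\<^sub>m d) *\<^sub>v v) $ i = 0\<^sub>v d $ i"
      using i B C by (simp add: scalar_prod_def v_def atLeast0LessThan)
  qed (use B in simp)
  moreover have "v \<noteq> 0\<^sub>v d"
  proof
    assume "v = 0\<^sub>v d"
    then have "v $ 0 = 0\<^sub>v d $ 0" by simp
    then show False
      using assms by (simp add: v_def)
  qed
  moreover have "v \<in> carrier_vec d"
    by (simp add: v_def)
  ultimately have "det (B - g \<cdot>\<^sub>m 1\<^sub>m d) = 0"
    using det_0_iff_vec_prod_zero[OF C] by blast
  \<comment> \<open>The two matrices agree modulo \<open>g\<close>, and the second has determinant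
    0, so \<open>g\<close> divides \<open>det B\<close>.\<close>
  moreover have "g dvd det B - det (B - g \<cdot>\<^sub>m 1\<^sub>m d)"
    using B by (intro dvd_diff_det[OF B C]) auto
  ultimately show ?thesis
    by (simp add: B_def norm_poly_def)
qed

text \<open>The monomial \<open>T^(d*e)\<close> comes from \<open>T^e\<close> by substituting
  \<open>T^d\<close>, so its norm is \<open>(T^e)^d\<close>, with the same exponent again.\<close>

lemma norm_poly_monom_mult:
  fixes u :: "'a::comm_ring_1 poly"
  assumes "d > 0"
  shows "norm_poly d (monom 1 (d * e) * u) = monom 1 (d * e) * norm_poly d u"
proof -
  have "pcompose (monom 1 e) (monom 1 d) = (monom 1 (d * e) :: 'a poly)"
    by (induction e) (simp_all add: monom_Suc pcompose_pCons mult_monom pcompose_1)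
  then show ?thesis
    using assms norm_poly_mult[of d "pcompose (monom 1 e) (monom 1 d)" u] norm_poly_pcompose[of d "monom 1 e :: 'a poly"]
    by (simp add: monom_power mult.commute)
qed

text \<open>The matrix entries depend linearly on the polynomial, so the norm can be computed modulo
  a constant.\<close>

lemma const_dvd_diff_norm_poly:
  assumes "d > 0" "[:c:] dvd f - g"
  shows "[:c:] dvd norm_poly d f - norm_poly d g"
  unfolding norm_poly_def
proof (rule dvd_diff_det[OF mult_matrix_carrier mult_matrix_carrier])
  fix i j assume "i < d" "j < d"
  obtain k where "f - g = [:c:] * k"
    using assms by blast
  then have k: "f = g + [:c:] * k"
    by (simp add: algebra_simps)
  show "[:c:] dvd mult_matrix d f $$ (i, j) - mult_matrix d g $$ (i, j)"
    using \<open>i < d\<close> \<open>j < d\<close> assms(1) dvd_triv_left[of "[:c:]" "section_poly d j (monom 1 i * k)"]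
    by (simp add: mult_matrix_def k distrib_left section_poly_add section_poly_smult)
qed

section \<open>Divisibility by constants and by prime elements\<close>

lemma prime_elem_const_int_poly:
  "prime (p::int) \<Longrightarrow> prime_elem [:p:]"
  using prime_elem_const_poly_iff prime_imp_prime_elem by blast

text \<open>Primitivity of \<open>P\<close>: if a nonunit constant split off, the other factor would
  be a unit and thus constant.\<close>

lemma irreducible_poly_not_const_dvd:
  fixes P :: "'a::idom poly"
  assumes "irreducible P" "degree P > 0" "\<not> c dvd 1"
  shows "\<not> [:c:] dvd P"
proof
  assume "[:c:] dvd P"
  then obtain Q where Q: "P = [:c:] * Q" by blast
  from assms(1) Q have "[:c:] dvd 1 \<or> Q dvd 1"
    by (rule irreducibleD)
  then have "degree Q = 0"
    using assms(3) by (auto simp: is_unit_const_poly_iff is_unit_poly_iff)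
  moreover have "degree P \<le> degree Q"
    using Q by (simp add: degree_smult_le)
  ultimately show False
    using assms(2) by simp
qed

lemma const_dvd_monom_mult_iff:
  "[:c:] dvd monom 1 n * g \<longleftrightarrow> [:c:] dvd (g :: 'a::idom poly)"
proof
  assume *: "[:c:] dvd monom 1 n * g"
  have "c dvd coeff (monom 1 n * g) (k + n)" for k
    using * by (simp only: const_poly_dvd_iff)
  then show "[:c:] dvd g"
    by (simp add: const_poly_dvd_iff coeff_monom_mult)
qed (rule dvd_mult)

lemma const_dvd_diff_monom_mult:
  fixes f :: "'a::idom poly"
  assumes "\<And>k. k < n \<Longrightarrow> c dvd coeff f k"
  shows "[:c:] dvd f - monom 1 n * poly_shift n f"
  using assms by (auto simp: const_poly_dvd_iff coeff_monom_mult coeff_poly_shift)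

text \<open>Modulo \<open>p\<close>, the factor \<open>h\<close> has nonzero constant term, so a
  power of \<open>T\<close> dividing \<open>g * h\<close> must divide \<open>g\<close>.\<close>

lemma prime_dvd_low_coeffs:
  fixes g h :: "'a::comm_ring_1 poly"
  assumes p: "prime_elem p" and h: "\<not> p dvd coeff h 0"
    and gh: "\<And>k. k < n \<Longrightarrow> p dvd coeff (g * h) k"
  shows "k < n \<Longrightarrow> p dvd coeff g k"
proof (induction k rule: less_induct)
  case (less k)
  have "coeff (g * h) k = (\<Sum>i<k. coeff g i * coeff h (k - i)) + coeff g k * coeff h 0"
    by (simp add: coeff_mult lessThan_Suc_atMost[symmetric])
  moreover have "p dvd (\<Sum>i<k. coeff g i * coeff h (k - i))"
    using less by (intro dvd_sum) auto
  ultimately have "p dvd coeff g k * coeff h 0"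
    using gh[OF less.prems] by (simp add: dvd_add_right_iff)
  then show ?case
    using p h by (simp add: prime_elem_dvd_mult_iff)
qed

text \<open>Induction on \<open>n\<close>: one \<open>p\<close> is cancelled from a factor that it
  divides, and \<open>k\<close> counts those taken from \<open>a\<close>.\<close>

lemma divisor_of_prime_elem_power:
  fixes p :: "'a::idom"
  assumes "prime_elem p" "a * b = p ^ n"
  obtains w k where "k \<le> n" "w dvd 1" "a = w * p ^ k"
proof -
  have "\<exists>w k. k \<le> n \<and> w dvd 1 \<and> a = w * p ^ k"
    using assms(2)
  proof (induction n arbitrary: a b)
    case 0
    then have "a dvd 1"
      by (metis dvd_triv_left power_0)
    then show ?case
      by (intro exI[of _ a] exI[of _ 0]) simp
  next
    case (Suc n)
    have "p \<noteq> 0"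
      using assms(1) by (rule prime_elem_not_zeroI)
    have "p dvd a * b"
      using Suc.prems by simp
    then consider a' where "a = p * a'" | b' where "b = p * b'"
      using assms(1) by (auto simp: prime_elem_dvd_mult_iff elim!: dvdE)
    then show ?case
    proof cases
      case 1
      then have "a' * b = p ^ n"
        using Suc.prems \<open>p \<noteq> 0\<close> by (simp add: mult.assoc)
      then obtain w k where "k \<le> n" "w dvd 1" "a' = w * p ^ k"
        using Suc.IH by blast
      then show ?thesis
        using 1 by (intro exI[of _ w] exI[of _ "Suc k"]) simp
    next
      case 2
      then have "p * (a * b') = p * p ^ n"
        using Suc.prems by (simp add: ac_simps)
      then have "a * b' = p ^ n"
        using \<open>p \<noteq> 0\<close> by simp
      then obtain w k where "k \<le> n" "w dvd 1" "a = w * p ^ k"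
        using Suc.IH by blast
      then show ?thesis
        by (intro exI[of _ w] exI[of _ k]) simp
    qed
  qed
  then show ?thesis
    using that by blast
qed

lemma prime_elem_dvd_prodE:
  fixes p :: "'a::comm_semiring_1"
  assumes "prime_elem p" "p dvd prod f A"
  obtains x where "x \<in> A" "p dvd f x"
proof -
  have "\<exists>x\<in>A. p dvd f x"
    using assms
    by (induction A rule: infinite_finite_induct)
      (auto simp: prime_elem_dvd_mult_iff dest: prime_elem_not_unit)
  then show ?thesis
    using that by blast
qed

section \<open>An Eisenstein-type criterion for \<open>P(T^d)\<close> and
  \<open>P(T^d + m)\<close>\<close>

text \<open>The norm of a factor \<open>g\<close> of \<open>P(T^d)\<close> divides \<open>P^d\<close>, hence is \<open>\<plusminus>P^k\<close> with \<open>k \<le> d\<close>. Modulo \<open>p\<close>,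
  the whole power of \<open>T\<close> in \<open>P(T^d)\<close> goes to \<open>g\<close> when \<open>p\<close> does not divide the constant term of the
  cofactor, which forces \<open>k = d\<close> and makes the norm of the cofactor a unit.\<close>

lemma is_unit_cofactor_of_pcompose_monom:
  fixes P g h :: "int poly"
  assumes d: "d > 0" and irred: "irreducible P" and deg: "degree P > 0"
    and p: "prime p" and p0: "p dvd coeff P 0"
    and gh: "pcompose P (monom 1 d) = g * h" and h: "\<not> p dvd coeff h 0"
  shows "h dvd 1"
proof -
  have "\<not> [:p:] dvd P"
    using irreducible_poly_not_const_dvd[OF irred deg] p not_prime_unit by blast
  then have ex: "\<exists>n. \<not> p dvd coeff P n"
    by (simp add: const_poly_dvd_iff)
  \<comment> \<open>The order of vanishing of \<open>P\<close> at 0 modulo \<open>p\<close>; it is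
    finite by primitivity and positive because \<open>p\<close> divides \<open>P(0)\<close>.\<close>
  define e where "e = (LEAST n. \<not> p dvd coeff P n)"
  have e: "\<not> p dvd coeff P e"
    unfolding e_def using ex by (rule LeastI_ex)
  have less_e: "p dvd coeff P k" if "k < e" for k
    using not_less_Least[of k "\<lambda>n. \<not> p dvd coeff P n"] that by (auto simp: e_def)
  have "e > 0"
    using e p0 by (cases e) auto
  define u where "u = poly_shift e P"
  have u0: "\<not> p dvd coeff u 0"
    using e by (simp add: u_def coeff_poly_shift)
  have Pu: "[:p:] dvd P - monom 1 e * u"
    unfolding u_def using less_e by (rule const_dvd_diff_monom_mult)

  \<comment> \<open>Only exponents divisible by \<open>d\<close> occur in \<open>P(T^d)\<close>, so
    its order modulo \<open>p\<close> is at least \<open>d * e\<close>.\<close>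
  have low: "p dvd coeff (pcompose P (monom 1 d)) n" if "n < d * e" for n
  proof -
    have "coeff (pcompose P (monom 1 d)) n = coeff (section_poly d (n mod d) (pcompose P (monom 1 d))) (n div d)"
      using d by (simp add: coeff_section_poly)
    also have "section_poly d (n mod d) (pcompose P (monom 1 d)) = P * (if n mod d = 0 then 1 else 0)"
      using section_poly_pcompose_monom_mult[of d "n mod d" P "monom 1 0"]
        section_poly_monom[of 0 d "n mod d", where 'a = int] d
      by (simp split: if_splits)
    finally show ?thesis
      using less_e[of "n div d"] that d by (simp add: less_mult_imp_div_less mult.commute)
  qed
  define v where "v = poly_shift (d * e) g"
  have "p dvd coeff g k" if "k < d * e" for k
    by (rule prime_dvd_low_coeffs[of p h "d * e"]) (use that low h p gh in auto)
  then have "[:p:] dvd g - monom 1 (d * e) * v"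
    unfolding v_def by (rule const_dvd_diff_monom_mult)
  then have Ng: "[:p:] dvd norm_poly d g - monom 1 (d * e) * norm_poly d v"
    using const_dvd_diff_norm_poly[OF d] by (metis norm_poly_monom_mult[OF d])

  have N: "norm_poly d g * norm_poly d h = P ^ d"
    using norm_poly_mult[OF d, of g h] norm_poly_pcompose[OF d, of P] gh by simp
  have "prime_elem P"
    using irred by (rule irreducible_imp_prime_poly)
  then obtain w k where k: "k \<le> d" and w: "w dvd 1" "norm_poly d g = w * P ^ k"
    using N by (rule divisor_of_prime_elem_power)
  have "k = d"
  proof (rule ccontr)
    assume "k \<noteq> d"
    then have "k < d" using k by simp
    have "[:p:] dvd P ^ k - (monom 1 e * u) ^ k"
      using dvd_diff_prod[of "{..<k}" "[:p:]" "\<lambda>_. P" "\<lambda>_. monom 1 e * u"] Pu by simp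
    then have "[:p:] dvd w * (P ^ k - (monom 1 e * u) ^ k)"
      by (rule dvd_mult)
    then have "[:p:] dvd norm_poly d g - w * (monom 1 e * u) ^ k"
      by (simp add: w right_diff_distrib)
    from dvd_diff[OF Ng this]
    have "[:p:] dvd w * (monom 1 e * u) ^ k - monom 1 (d * e) * norm_poly d v"
      by simp
    \<comment> \<open>Modulo \<open>p\<close> the norm of \<open>g\<close> is both a multiple of
      \<open>T^(d*e)\<close> and equal to \<open>w * (T^e * u)^k\<close>. Cancelling
      \<open>T^(e*k)\<close> leaves a multiple of \<open>T^(e*(d-k))\<close>, whose constant term is
      0, opposite the constant term of \<open>w * u^k\<close>, which \<open>p\<close> does not
      divide.\<close>
    also have "monom 1 (d * e) = (monom 1 (e * k) * monom 1 (e * (d - k)) :: int poly)"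
      using \<open>k < d\<close> by (simp add: mult_monom distrib_left[symmetric] mult.commute)
    also have "w * (monom 1 e * u) ^ k - monom 1 (e * k) * monom 1 (e * (d - k)) * norm_poly d v
        = monom 1 (e * k) * (w * u ^ k - monom 1 (e * (d - k)) * norm_poly d v)"
      by (simp add: power_mult_distrib monom_power algebra_simps)
    finally have "[:p:] dvd w * u ^ k - monom 1 (e * (d - k)) * norm_poly d v"
      by (simp only: const_dvd_monom_mult_iff)
    then have "p dvd coeff (w * u ^ k - monom 1 (e * (d - k)) * norm_poly d v) 0"
      by (simp only: const_poly_dvd_iff)
    then have "p dvd coeff w 0 * coeff u 0 ^ k"
      using \<open>e > 0\<close> \<open>k < d\<close> by (simp add: coeff_monom_mult coeff_mult_0 coeff_0_power)
    then have "p dvd coeff w 0"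
      using p u0 by (auto simp: prime_dvd_mult_iff dest: prime_dvd_power)
    moreover have "coeff w 0 dvd 1"
      using w(1) by (auto simp: is_unit_poly_iff)
    ultimately show False
      using p not_prime_unit dvd_trans by blast
  qed
  then have "P ^ d * (w * norm_poly d h) = P ^ d * 1"
    using N w by (simp add: algebra_simps)
  moreover have "P ^ d \<noteq> 0"
    using deg by auto
  ultimately have "w * norm_poly d h = 1"
    using mult_left_cancel by blast
  then have "norm_poly d h dvd 1"
    by (metis dvd_triv_right)
  then obtain c where "norm_poly d h = [:c:]" "c dvd 1"
    by (auto simp: is_unit_poly_iff)
  \<comment> \<open>A constant is unchanged by substituting \<open>T^d\<close>, and \<open>h\<close>
    divides its norm after that substitution.\<close>
  then show "h dvd 1"
    using dvd_norm_poly_pcompose[OF d, of h] dvd_trans[of h "[:c:]" 1]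
    by (simp add: is_unit_const_poly_iff)
qed

text \<open>In a factorisation \<open>g * h\<close> the constant terms multiply to
  \<open>P(0)\<close>, so \<open>p\<close> divides at most one of them; a factor whose constant term
  it misses is a unit.\<close>

lemma irreducible_pcompose_monom:
  fixes P :: "int poly"
  assumes d: "d > 0" and irred: "irreducible P" and deg: "degree P > 0"
    and p: "prime p" "p dvd coeff P 0" "\<not> p\<^sup>2 dvd coeff P 0"
  shows "irreducible (pcompose P (monom 1 d))"
proof (rule irreducibleI)
  have deg': "degree (pcompose P (monom 1 d)) > 0"
    using d deg by (simp add: degree_pcompose degree_monom_eq)
  then show "pcompose P (monom 1 d) \<noteq> 0"
    by force
  show "\<not> pcompose P (monom 1 d) dvd 1"
    using deg' by (auto simp: is_unit_poly_iff)
  fix g h assume gh: "pcompose P (monom 1 d) = g * h"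
  have "coeff (pcompose P (monom 1 d)) 0 = coeff P 0"
    using d by (simp add: pcompose_coeff_0 poly_monom poly_0_coeff_0 zero_power)
  then have "coeff P 0 = coeff g 0 * coeff h 0"
    by (simp add: gh coeff_mult_0)
  with p(3) have "\<not> (p dvd coeff g 0 \<and> p dvd coeff h 0)"
    using mult_dvd_mono[of p "coeff g 0" p "coeff h 0"] by (auto simp: power2_eq_square)
  then show "g dvd 1 \<or> h dvd 1"
    using is_unit_cofactor_of_pcompose_monom[OF d irred deg p(1,2), of g h]
      is_unit_cofactor_of_pcompose_monom[OF d irred deg p(1,2), of h g] gh
    by (auto simp: mult.commute)
qed

text \<open>Translation by \<open>m\<close> is a ring automorphism, inverted by translation by
  \<open>-m\<close>, so units and factorisations carry over.\<close>

lemma irreducible_pcompose_translate: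
  fixes P :: "'a::idom poly"
  assumes "irreducible P"
  shows "irreducible (pcompose P [:m, 1:])"
proof (rule irreducibleI)
  have inv: "pcompose (pcompose Q [:n, 1:]) [:-n, 1:] = Q" for Q :: "'a poly" and n
    by (simp add: pcompose_assoc[symmetric] pcompose_pCons)
  have unit: "Q dvd 1" if "pcompose Q [:n, 1:] dvd 1" for Q :: "'a poly" and n
  proof -
    from that obtain R where "1 = pcompose Q [:n, 1:] * R" by (rule dvdE)
    then have "1 = pcompose (pcompose Q [:n, 1:] * R) [:-n, 1:]"
      by (simp add: pcompose_1 flip: \<open>1 = _\<close>)
    then have "1 = Q * pcompose R [:-n, 1:]"
      by (simp only: pcompose_mult inv)
    then show ?thesis
      by (rule dvdI)
  qed
  show "pcompose P [:m, 1:] \<noteq> 0"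
    using assms inv[of P m] by auto
  show "\<not> pcompose P [:m, 1:] dvd 1"
    using assms unit[of P m] by (auto dest: irreducible_not_unit)
  fix a b assume "pcompose P [:m, 1:] = a * b"
  then have "P = pcompose a [:-m, 1:] * pcompose b [:-m, 1:]"
    using inv[of P m] by (simp add: pcompose_mult)
  with assms have "pcompose a [:-m, 1:] dvd 1 \<or> pcompose b [:-m, 1:] dvd 1"
    by (rule irreducibleD)
  then show "a dvd 1 \<or> b dvd 1"
    using unit by blast
qed

lemma irreducible_pcompose_monom_plus_const:
  fixes P :: "int poly"
  assumes "d > 0" "irreducible P" "degree P > 0"
    and "prime p" "p dvd poly P m" "\<not> p\<^sup>2 dvd poly P m"
  shows "irreducible (pcompose P (monom 1 d + [:m:]))"
proof -
  have "irreducible (pcompose (pcompose P [:m, 1:]) (monom 1 d))"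
    by (rule irreducible_pcompose_monom[where p = p])
      (use assms in \<open>simp_all add: irreducible_pcompose_translate degree_pcompose pcompose_coeff_0\<close>)
  also have "pcompose (pcompose P [:m, 1:]) (monom 1 d) = pcompose P (monom 1 d + [:m:])"
    by (simp add: pcompose_assoc[symmetric] pcompose_pCons add.commute)
  finally show ?thesis .
qed

section \<open>Large primes dividing values of a polynomial exactly once\<close>

text \<open>Euclid's argument: at a multiple of \<open>P(0) * N!\<close> the value of
  \<open>P\<close> is \<open>P(0)\<close> times a number congruent to 1 modulo \<open>N!\<close>,
  whose prime divisors exceed \<open>N\<close>. If \<open>P(0) = 0\<close>, every prime divides a
  value.\<close>

lemma exists_prime_dvd_poly_value:
  fixes P :: "int poly"
  assumes "degree P > 0"
  shows "\<exists>p m. prime p \<and> p > int N \<and> p dvd poly P m"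
proof (cases "poly P 0 = 0")
  case True
  obtain q :: nat where "prime q" "q > N"
    using bigger_prime by blast
  then show ?thesis
    using True by (intro exI[of _ "int q"] exI[of _ 0]) auto
next
  case False
  define c where "c = poly P 0"
  define F :: int where "F = fact N"
  obtain R where PR: "P = pCons c R"
    by (metis c_def pCons_cases poly_0_coeff_0 coeff_pCons_0)
  have "c * F \<noteq> 0"
    using False by (simp add: c_def F_def)
  have ne: "P - [:a:] \<noteq> 0" for a
    using assms by (metis degree_pCons_0 eq_iff_diff_eq_0 less_irrefl)
  \<comment> \<open>Avoiding the values \<open>0\<close>, \<open>c\<close> and \<open>-c\<close> of
    \<open>P\<close> ensures that the cofactor \<open>V\<close> below is none of \<open>0\<close>,
    \<open>1\<close>, \<open>-1\<close>.\<close>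
  have "finite {y. poly ((P - [:0:]) * (P - [:c:]) * (P - [:-c:])) y = 0}"
    by (rule poly_roots_finite) (use ne[of 0] ne[of c] ne[of "-c"] in simp)
  moreover have "infinite (range (\<lambda>t. c * F * t))"
    using \<open>c * F \<noteq> 0\<close> by (auto simp: inj_on_def dest: finite_imageD)
  ultimately obtain t where t: "poly ((P - [:0:]) * (P - [:c:]) * (P - [:-c:])) (c * F * t) \<noteq> 0"
    by (metis (mono_tags, lifting) finite_subset image_subset_iff mem_Collect_eq)
  define V where "V = 1 + F * t * poly R (c * F * t)"
  have V: "poly P (c * F * t) = c * V"
    by (simp add: PR V_def algebra_simps)
  have "\<not> V dvd 1"
    using t V by (auto simp: abs_eq_iff')
  then obtain p where p: "prime p" "p dvd V"
    using prime_divisor_exists[of V] t V by auto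
  have "p > int N"
  proof (rule ccontr)
    assume "\<not> p > int N"
    then have "nat p \<le> N" "nat p \<ge> 1" "p = int (nat p)"
      using p(1) prime_gt_0_int[of p] by auto
    then have "p dvd F"
      by (metis F_def dvd_fact int_dvd_int_iff of_nat_fact)
    then have "p dvd F * t * poly R (c * F * t)"
      by simp
    with p(2) have "p dvd 1"
      unfolding V_def by (simp add: dvd_add_left_iff)
    then show False
      using p(1) not_prime_unit by blast
  qed
  moreover have "p dvd poly P (c * F * t)"
    using p(2) V by simp
  ultimately show ?thesis
    using p(1) by blast
qed

text \<open>A nonzero \<open>f\<close> of least degree in the ideal of \<open>P\<close> and
  \<open>P'\<close> divides constant multiples of both. The prime \<open>P\<close> cannot divide
  \<open>f\<close>, or it would divide a multiple of \<open>P'\<close>, of smaller degree; hence it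
  divides the cofactor \<open>q\<close>, and \<open>f\<close> is constant.\<close>

lemma exists_const_combination_pderiv:
  fixes P :: "int poly"
  assumes irred: "irreducible P" and deg: "degree P > 0"
  shows "\<exists>A B r. r \<noteq> 0 \<and> A * P + B * pderiv P = [:r:]"
proof -
  define S where "S = {f. f \<noteq> 0 \<and> (\<exists>A B. f = A * P + B * pderiv P)}"
  have "P \<in> S"
    using deg by (auto simp: S_def intro: exI[of _ 1] exI[of _ 0])
  then obtain f where f: "f \<in> S" and min: "\<And>g. g \<in> S \<Longrightarrow> degree f \<le> degree g"
    using arg_min_nat_lemma[of "\<lambda>f. f \<in> S" P degree] by blast
  then obtain A B where AB: "f \<noteq> 0" "f = A * P + B * pderiv P"
    by (auto simp: S_def)
  \<comment> \<open>Pseudo-division stands in for division over the rationals; the remainder lies in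
    the ideal, so minimality makes it 0.\<close>
  have div: "\<exists>a q. a \<noteq> 0 \<and> Polynomial.smult a g = f * q" if g: "g = C * P + D * pderiv P" for g C D
  proof -
    obtain a q where a: "a \<noteq> 0" "Polynomial.smult a g = f * q + pseudo_mod g f"
      using pseudo_mod(1)[OF AB(1)] by blast
    have "pseudo_mod g f = Polynomial.smult a g - f * q"
      using a by simp
    also have "\<dots> = (Polynomial.smult a C - q * A) * P + (Polynomial.smult a D - q * B) * pderiv P"
      by (simp add: g AB(2) algebra_simps smult_add_right)
    finally have "pseudo_mod g f = 0"
      using pseudo_mod(2)[OF AB(1), of g] min[of "pseudo_mod g f"]
      by (force simp: S_def)
    then show ?thesis using a by auto
  qed
  obtain a q where aq: "a \<noteq> 0" "Polynomial.smult a P = f * q"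
    using div[of P 1 0] by auto
  obtain b s where bs: "b \<noteq> 0" "Polynomial.smult b (pderiv P) = f * s"
    using div[of "pderiv P" 0 1] by auto
  have prime: "prime_elem P"
    using irred by (rule irreducible_imp_prime_poly)
  have small: "\<not> P dvd Polynomial.smult b (pderiv P)"
  proof
    assume "P dvd Polynomial.smult b (pderiv P)"
    moreover have "pderiv P \<noteq> 0"
      using deg by (simp add: pderiv_eq_0_iff)
    ultimately have "degree P \<le> degree (pderiv P)"
      using bs(1) dvd_imp_degree_le[of P "Polynomial.smult b (pderiv P)"] by simp
    then show False
      using deg by (simp add: degree_pderiv)
  qed
  have "P dvd f * q"
    using aq(2) by (metis dvd_smult dvd_refl)
  moreover have "\<not> P dvd f"
    using small bs(2) by (metis dvd_mult2)
  ultimately have "P dvd q"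
    using prime by (simp add: prime_elem_dvd_mult_iff)
  moreover have "q \<noteq> 0"
    using aq deg by auto
  ultimately have "degree P \<le> degree q"
    by (rule dvd_imp_degree_le)
  moreover have "degree P = degree f + degree q"
    using arg_cong[OF aq(2), of degree] aq(1) AB(1) \<open>q \<noteq> 0\<close> by (simp add: degree_mult_eq)
  ultimately have "degree f = 0"
    by simp
  then obtain r where "f = [:r:]"
    by (rule degree_eq_zeroE)
  then show ?thesis
    using AB by (intro exI[of _ A] exI[of _ B] exI[of _ r]) auto
qed

lemma poly_add_taylor_dvd:
  fixes P :: "'a::idom poly"
  shows "h\<^sup>2 dvd poly P (x + h) - poly P x - h * poly (pderiv P) x"
proof (induction P)
  case (pCons a P)
  then obtain k where k: "poly P (x + h) - poly P x - h * poly (pderiv P) x = h\<^sup>2 * k"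
    by blast
  have "poly (pCons a P) (x + h) - poly (pCons a P) x - h * poly (pderiv (pCons a P)) x
      = (x + h) * (poly P (x + h) - poly P x - h * poly (pderiv P) x) + h\<^sup>2 * poly (pderiv P) x"
    by (simp only: pderiv_pCons poly_pCons poly_add) (simp add: algebra_simps power2_eq_square)
  also have "\<dots> = h\<^sup>2 * ((x + h) * k + poly (pderiv P) x)"
    by (simp only: k) (simp add: algebra_simps)
  finally show ?case
    by simp
qed simp

text \<open>If \<open>p\<^sup>2\<close> divides both \<open>P(m)\<close> and \<open>P(m + p)\<close>, then \<open>p\<close> divides \<open>P'(m)\<close>, hence also the nonzero
  constant generated by \<open>P\<close> and \<open>P'\<close>; large \<open>p\<close> exclude this.\<close>

lemma exists_prime_exactly_dvd_poly_value:
  fixes P :: "int poly"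
  assumes "irreducible P" "degree P > 0"
  shows "\<exists>p m. prime p \<and> p > int N \<and> p dvd poly P m \<and> \<not> p\<^sup>2 dvd poly P m"
proof -
  obtain A B r where r: "r \<noteq> 0" "A * P + B * pderiv P = [:r:]"
    using exists_const_combination_pderiv[OF assms] by blast
  \<comment> \<open>The bound exceeds both \<open>N\<close> and the size of \<open>r\<close>, so
    that \<open>p\<close> cannot divide \<open>r\<close>.\<close>
  obtain p m where p: "prime p" "p > int (N + nat \<bar>r\<bar>)" "p dvd poly P m"
    using exists_prime_dvd_poly_value[OF assms(2)] by blast
  have "\<not> p dvd r"
    using p(2) r(1) zdvd_imp_le[of p "\<bar>r\<bar>"] by auto
  moreover have "r = poly A m * poly P m + poly B m * poly (pderiv P) m"
    using arg_cong[OF r(2), of "\<lambda>f. poly f m"] by simp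
  ultimately have p': "\<not> p dvd poly (pderiv P) m"
    using p(3) by auto
  have "\<not> p\<^sup>2 dvd poly P m \<or> \<not> p\<^sup>2 dvd poly P (m + p)"
  proof (rule ccontr)
    assume "\<not> ?thesis"
    then have *: "p\<^sup>2 dvd poly P (m + p) - poly P m"
      by simp
    have "p\<^sup>2 dvd p * poly (pderiv P) m"
      using dvd_diff[OF * poly_add_taylor_dvd[of p P m]] by simp
    then show False
      using p' p(1) by (simp add: power2_eq_square)
  qed
  moreover have "p dvd poly P (m + p)"
  proof -
    have "p dvd poly P (m + p) - poly P m - p * poly (pderiv P) m"
      using poly_add_taylor_dvd[of p P m] by (metis dvd_trans dvd_triv_left power2_eq_square)
    from dvd_add[OF this dvd_add[OF p(3) dvd_triv_left[of p "poly (pderiv P) m"]]] show ?thesis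
      by simp
  qed
  moreover have "p > int N"
    using p(2) by simp
  ultimately show ?thesis
    using p(1,3) by blast
qed

section \<open>Choosing arguments by the Chinese remainder theorem\<close>

lemma cong_poly_int:
  fixes P :: "int poly"
  assumes "[x = y] (mod n)"
  shows "[poly P x = poly P y] (mod n)"
  by (induction P) (simp_all add: cong_add cong_mult assms)

lemma exists_value_avoiding_primes:
  fixes F :: "int poly" and S :: "int set"
  assumes "finite S" "\<And>l. l \<in> S \<Longrightarrow> prime l" "\<And>l. l \<in> S \<Longrightarrow> \<exists>t. \<not> l dvd poly F t"
  shows "\<exists>a. \<forall>l\<in>S. \<not> l dvd poly F a"
  using assms
proof (induction S rule: finite_induct)
  case (insert l S)
  then obtain a where a: "\<forall>l\<in>S. \<not> l dvd poly F a"
    by auto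
  obtain t where t: "\<not> l dvd poly F t"
    using insert by blast
  have "coprime (\<Prod>S) l"
    using insert by (intro prod_coprime_left) (metis insert_iff primes_coprime)
  then obtain b where b: "[b = a] (mod \<Prod>S)" "[b = t] (mod l)"
    using binary_chinese_remainder_int by blast
  have "\<not> q dvd poly F b" if "q \<in> S" for q
  proof -
    have "[b = a] (mod q)"
      using b(1) that insert.hyps(1) by (meson cong_dvd_modulus dvd_prodI)
    then show ?thesis
      using a that cong_poly_int cong_dvd_iff by blast
  qed
  moreover have "\<not> l dvd poly F b"
    using b(2) t cong_poly_int cong_dvd_iff by blast
  ultimately show ?case
    by auto
qed simp

text \<open>The modulus \<open>Q\<close> is general so that the induction can pass to
  \<open>Q * p^2\<close>: fixing the argument modulo \<open>p^2\<close> protects the exact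
  divisibility by \<open>p\<close> from later choices.\<close>

lemma exists_cong_exactly_dvd_poly_values:
  fixes P :: "'i \<Rightarrow> int poly"
  assumes "finite I" "\<And>i. i \<in> I \<Longrightarrow> irreducible (P i)" "\<And>i. i \<in> I \<Longrightarrow> degree (P i) > 0" "Q > 0"
  shows "\<exists>m. [m = a] (mod Q) \<and> (\<forall>i\<in>I. \<exists>p. prime p \<and> p dvd poly (P i) m \<and> \<not> p\<^sup>2 dvd poly (P i) m)"
  using assms
proof (induction I arbitrary: a Q rule: finite_induct)
  case empty
  then show ?case
    by (intro exI[of _ a]) auto
next
  case (insert i I)
  \<comment> \<open>Taking \<open>p > Q\<close> makes \<open>p^2\<close> coprime to
    \<open>Q\<close>.\<close>
  obtain p n where p: "prime p" "p > int (nat Q)" "p dvd poly (P i) n" "\<not> p\<^sup>2 dvd poly (P i) n"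
    using exists_prime_exactly_dvd_poly_value[OF insert.prems(1,2), of i "nat Q"] by auto
  have "\<not> p dvd Q"
    using p(2) insert.prems(3) zdvd_imp_le[of p Q] by auto
  then have "coprime Q (p\<^sup>2)"
    using p(1) prime_imp_coprime[of p Q] by (simp add: coprime_commute)
  then obtain b where b: "[b = a] (mod Q)" "[b = n] (mod p\<^sup>2)"
    using binary_chinese_remainder_int by blast
  have "Q * p\<^sup>2 > 0"
    using insert.prems(3) p(1) prime_gt_0_int[of p] by simp
  then obtain m where m: "[m = b] (mod Q * p\<^sup>2)"
    "\<forall>i\<in>I. \<exists>p. prime p \<and> p dvd poly (P i) m \<and> \<not> p\<^sup>2 dvd poly (P i) m"
    using insert.IH[of "Q * p\<^sup>2" b] insert.prems by auto
  have "[m = a] (mod Q)"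
    using m(1) b(1) by (meson cong_dvd_modulus cong_trans dvd_triv_left)
  moreover have "[m = n] (mod p\<^sup>2)"
    using m(1) b(2) by (meson cong_dvd_modulus cong_trans dvd_triv_right)
  then have "[poly (P i) m = poly (P i) n] (mod p\<^sup>2)" "[poly (P i) m = poly (P i) n] (mod p)"
    by (auto intro!: cong_poly_int elim!: cong_dvd_modulus)
  then have "p dvd poly (P i) m" "\<not> p\<^sup>2 dvd poly (P i) m"
    using p(3,4) by (simp_all add: cong_dvd_iff)
  ultimately show ?case
    using m(2) p(1) by auto
qed

section \<open>Fixed prime divisors and the choice of \<open>M\<close>\<close>

text \<open>Over the field with \<open>p\<close> elements, a nonzero polynomial of degree at most
  \<open>n\<close> has at most \<open>n\<close> roots, while \<open>0, ..., n\<close> are distinct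
  modulo \<open>p\<close>. The induction splits off the last root.\<close>

lemma prime_dvd_values_imp_const_dvd:
  fixes G :: "int poly"
  assumes "prime p" "degree G \<le> n" "int n < p" "\<And>t. t \<in> {0..int n} \<Longrightarrow> p dvd poly G t"
  shows "[:p:] dvd G"
  using assms(2-4)
proof (induction n arbitrary: G)
  case 0
  then obtain c where "G = [:c:]"
    by (auto elim: degree_eq_zeroE)
  then show ?case
    using 0 by simp
next
  case (Suc n)
  define H where "H = synthetic_div G (int (Suc n))"
  define c where "c = poly G (int (Suc n))"
  have G: "G = [:- int (Suc n), 1:] * H + [:c:]"
    unfolding H_def c_def by (rule synthetic_div_correct'[symmetric])
  have c: "p dvd c"
    using Suc.prems by (simp add: c_def)
  have "p dvd poly H t" if t: "t \<in> {0..int n}" for t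
  proof -
    have "p dvd poly G t - c"
      using Suc.prems c t by (intro dvd_diff) auto
    also have "poly G t - c = (t - int (Suc n)) * poly H t"
      by (subst G) (simp add: algebra_simps)
    finally have "p dvd t - int (Suc n) \<or> p dvd poly H t"
      using assms(1) by (simp add: prime_dvd_mult_iff)
    moreover have "\<not> p dvd t - int (Suc n)"
      using zdvd_imp_le[of p "int (Suc n) - t"] t Suc.prems(2) by (auto simp: dvd_diff_commute)
    ultimately show ?thesis
      by blast
  qed
  moreover have "degree H \<le> n"
    using Suc.prems(1) by (simp add: H_def degree_synthetic_div)
  ultimately have "[:p:] dvd H"
    using Suc.IH Suc.prems(2) by simp
  then show ?case
    using c by (subst G) (intro dvd_add dvd_mult, simp_all)
qed

theorem theorem1p3:
  fixes P :: "nat \<Rightarrow> int poly" and s d :: nat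
  assumes irred: "\<And>i. i \<in> {1..s} \<Longrightarrow> irreducible (P i)"
    and no_fixed: "\<not> has_fixed_divisor (\<Prod>i=1..s. P i)"
    and d: "d \<ge> 1"
  shows "\<exists>M :: int poly. lead_coeff M = 1 \<and> degree M = d \<and>
    (\<forall>i\<in>{1..s}. irreducible (pcompose (P i) M)) \<and>
    \<not> has_fixed_divisor (\<Prod>i=1..s. pcompose (P i) M)"
proof -
  define F where "F = (\<Prod>i=1..s. P i)"
  \<comment> \<open>An irreducible constant would itself be a fixed divisor of the product.\<close>
  have pos: "degree (P i) > 0" if i: "i \<in> {1..s}" for i
  proof (rule ccontr)
    assume "\<not> degree (P i) > 0"
    then obtain c where c: "P i = [:c:]"
      by (auto elim: degree_eq_zeroE)
    have "c \<noteq> 0" "\<not> c dvd 1"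
      using irred[OF i] by (auto simp: c irreducible_def is_unit_const_poly_iff)
    moreover have "c dvd poly F x" for x
      using i c by (auto simp: F_def poly_prod intro!: dvd_prod_eqI[of _ i])
    ultimately have "has_fixed_divisor F"
      by (auto simp: has_fixed_divisor_def fixed_divisor_def intro!: exI[of _ c])
    then show False
      using no_fixed by (simp add: F_def)
  qed
  \<comment> \<open>This is the degree of \<open>F(M)\<close>. Primes up to \<open>D\<close> are
    excluded by the choice of \<open>m\<close>, larger ones by counting roots.\<close>
  define D where "D = degree F * d"
  define S where "S = {l::int. prime l \<and> l \<le> int D}"
  have "S \<subseteq> {0..int D}"
    by (auto simp: S_def dest: prime_ge_0_int)
  then have finS: "finite S"
    by (rule finite_subset) simp
  have "\<exists>t. \<not> l dvd poly F t" if "prime l" for l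
  proof -
    have "l \<notin> {0, 1, -1}"
      using that by (auto dest: prime_gt_1_int)
    then show ?thesis
      using no_fixed unfolding has_fixed_divisor_def fixed_divisor_def F_def by blast
  qed
  then obtain a where a: "\<forall>l\<in>S. \<not> l dvd poly F a"
    using exists_value_avoiding_primes[OF finS, of F] by (auto simp: S_def)
  have "\<Prod>S > 0"
    by (intro prod_pos) (auto simp: S_def prime_gt_0_int)
  then obtain m where m: "[m = a] (mod \<Prod>S)"
    "\<forall>i\<in>{1..s}. \<exists>p. prime p \<and> p dvd poly (P i) m \<and> \<not> p\<^sup>2 dvd poly (P i) m"
    using exists_cong_exactly_dvd_poly_values[of "{1..s}" P "\<Prod>S" a] irred pos by auto
  define M :: "int poly" where "M = monom 1 d + [:m:]"
  have degM: "degree M = d"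
    unfolding M_def using d by (subst degree_add_eq_left) (simp_all add: degree_monom_eq)
  have lcM: "lead_coeff M = 1"
    unfolding degM using d by (simp add: M_def coeff_pCons split: nat.split)
  have irredM: "irreducible (pcompose (P i) M)" if i: "i \<in> {1..s}" for i
  proof -
    obtain p where "prime p" "p dvd poly (P i) m" "\<not> p\<^sup>2 dvd poly (P i) m"
      using m(2) i by blast
    with d irred[OF i] pos[OF i] show ?thesis
      unfolding M_def by (intro irreducible_pcompose_monom_plus_const) auto
  qed
  have FM: "(\<Prod>i=1..s. pcompose (P i) M) = pcompose F M"
    by (simp add: F_def pcompose_prod)
  have "\<not> has_fixed_divisor (pcompose F M)"
  proof
    assume "has_fixed_divisor (pcompose F M)"
    then obtain c where c: "c \<noteq> 0" "\<not> c dvd 1" "\<And>t. c dvd poly (pcompose F M) t"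
      by (auto simp: has_fixed_divisor_def fixed_divisor_def)
    then obtain l where l: "prime l" "l dvd c"
      using prime_divisor_exists by blast
    have ldvd: "l dvd poly (pcompose F M) t" for t
      using c(3) l(2) dvd_trans by blast
    show False
    proof (cases "l \<le> int D")
      case True
      then have "l \<in> S" using l by (simp add: S_def)
      \<comment> \<open>The value of \<open>F(M)\<close> at 0 is \<open>F(m)\<close>, congruent to
        \<open>F(a)\<close> modulo \<open>l\<close>, which \<open>l\<close> does not divide.\<close>
      then have "[m = a] (mod l)"
        using m(1) finS by (meson cong_dvd_modulus dvd_prodI)
      moreover have "poly M 0 = m"
        using d by (simp add: M_def poly_monom)
      then have "l dvd poly F m"
        using ldvd[of 0] by (simp add: poly_pcompose)
      ultimately have "l dvd poly F a"
        using cong_poly_int cong_dvd_iff by blast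
      then show False
        using a \<open>l \<in> S\<close> by blast
    next
      case False
      \<comment> \<open>As \<open>l > D\<close>, divisibility of all values passes to the
        coefficients; then \<open>l\<close> divides one of the factors, against its
        primitivity.\<close>
      have "[:l:] dvd pcompose F M"
        using False l(1) ldvd
        by (intro prime_dvd_values_imp_const_dvd[of l _ D]) (auto simp: D_def degree_pcompose degM)
      then have "[:l:] dvd (\<Prod>i=1..s. pcompose (P i) M)"
        by (simp only: FM)
      then obtain i where "i \<in> {1..s}" "[:l:] dvd pcompose (P i) M"
        using prime_elem_const_int_poly[OF l(1)] by (elim prime_elem_dvd_prodE)
      moreover have "degree (pcompose (P i) M) > 0"
        using pos[of i] \<open>i \<in> {1..s}\<close> d by (simp add: degree_pcompose degM)
      ultimately show False
        using irreducible_poly_not_const_dvd irredM l(1) not_prime_unit by blast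
    qed
  qed
  then show ?thesis
    using degM lcM irredM FM by auto
qed

end
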